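(* Let $\mathcal{G}$ be a finite simple connected graph. There exists $\beta_->0$ (depending only on $\mathcal{G}$) such that for every fixed $\beta$ with $0\le\beta<\beta_-$ the mixing time of the Attracting Random Walks (ARW) chain with $n$ particles on $\mathcal{G}$ with parameter $\beta$ is $O(n\log n)$ as $n\to\infty$; i.e. there exist $C>0$ and $n_0$ (depending on $\mathcal{G},\beta$) such that the mixing time is at most $Cn\log n$ for all $n\ge n_0$.
   Context: ARW chain: let $\mathcal{G}=(\mathcal{V},\mathcal{E})$ be a finite simple connected graph with $k=|\mathcal{V}|$ vertices; write $i\sim j$ if $(i,j)\in\mathcal{E}$. For $n\ge1$ the state space is $\Omega=\{x\in\mathbb{Z}_{\ge0}^{\mathcal{V}}:\sum_i x(i)=n\}$ ($x(i)$ is the number of indistinguishable particles at vertex $i$). For $\beta\in\mathbb{R}$, one step from $x$ is: choose one of the $n$ particles uniformly at random, say located at $i$; move it to a neighbor $j\sim i$ with probability $\frac1Z\exp(\frac{\beta}{n}x(j))$, or keep it at $i$ with probability $\frac1Z\exp(\frac{\beta}{n}(x(i)-1))$, where $Z=\sum_{l\sim i}\exp(\frac{\beta}{n}x(l))+\exp(\frac{\beta}{n}(x(i)-1))$. Let $P$ be the transition matrix and $\pi$ the stationary distribution. Mixing time: $d(X,t)=\max_{x\in\Omega}\|P^t(x,\cdot)-\pi\|_{\mathrm{TV}}$ and $t_{\mathrm{mix}}(X,\epsilon)=\min\{t: d(X,t)\le\epsilon\}$. "The mixing time" means $t_{\mathrm{mix}}(X,1/4)$. The graph and $\beta$ are fixed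 while $n\to\infty$. *)

theory Defs
  imports
    "HOL-Probability.Probability"
    "Graph_Theory.Graph_Theory"
begin

definition tv_dist :: "'s pmf \<Rightarrow> 's pmf \<Rightarrow> real" where
  "tv_dist \<mu> \<nu> = (SUP A. \<bar>measure_pmf.prob \<mu> A - measure_pmf.prob \<nu> A\<bar>)"

text \<open>
  A Markov chain on a finite set \<open>S\<close> of states is given by its transition kernel
  \<open>K\<close>, the entry of the transition matrix at \<open>(x, y)\<close> being \<open>pmf (K x) y\<close>; thus
  \<open>pmf (kernel_power K t x)\<close> is the row of \<open>x\<close> in the \<open>t\<close>-th matrix power.
\<close>

primrec kernel_power :: "('s \<Rightarrow> 's pmf) \<Rightarrow> nat \<Rightarrow> 's \<Rightarrow> 's pmf" where
  "kernel_power K 0 x = return_pmf x"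
| "kernel_power K (Suc t) x = bind_pmf (kernel_power K t x) K"

definition is_stationary :: "'s set \<Rightarrow> ('s \<Rightarrow> 's pmf) \<Rightarrow> 's pmf \<Rightarrow> bool" where
  "is_stationary S K \<pi> \<longleftrightarrow> set_pmf \<pi> \<subseteq> S \<and> bind_pmf \<pi> K = \<pi>"

definition stationary_pmf :: "'s set \<Rightarrow> ('s \<Rightarrow> 's pmf) \<Rightarrow> 's pmf" where
  "stationary_pmf S K = (THE \<pi>. is_stationary S K \<pi>)"

definition mixing_dist :: "'s set \<Rightarrow> ('s \<Rightarrow> 's pmf) \<Rightarrow> nat \<Rightarrow> real" where
  "mixing_dist S K t = (MAX x\<in>S. tv_dist (kernel_power K t x) (stationary_pmf S K))"

text \<open>
  The value is an extended natural number so that it is \<open>\<infinity>\<close>, rather than an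
  unspecified number, for a chain that never gets \<open>\<epsilon>\<close>-close to stationarity.
\<close>

definition mixing_time :: "'s set \<Rightarrow> ('s \<Rightarrow> 's pmf) \<Rightarrow> real \<Rightarrow> enat" where
  "mixing_time S K \<epsilon> = (INF t\<in>{t. mixing_dist S K t \<le> \<epsilon>}. enat t)"

text \<open>
  A configuration of indistinguishable particles is the multiset of their positions:
  \<open>count x i\<close> is the number of particles at the vertex \<open>i\<close>.  Undirected graphs are
  symmetric digraphs, so that \<open>i \<rightarrow>\<^bsub>G\<^esub> j\<close> says that \<open>i\<close> and \<open>j\<close> are adjacent.
\<close>

definition arw_states :: "('v, 'e) pre_digraph \<Rightarrow> nat \<Rightarrow> 'v multiset set" where
  "arw_states G n = {x. set_mset x \<subseteq> verts G \<and> size x = n}"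

definition arw_Z :: "('v, 'e) pre_digraph \<Rightarrow> real \<Rightarrow> nat \<Rightarrow> 'v multiset \<Rightarrow> 'v \<Rightarrow> real" where
  "arw_Z G \<beta> n x i =
     (\<Sum>l | i \<rightarrow>\<^bsub>G\<^esub> l. exp (\<beta> / real n * real (count x l))) +
     exp (\<beta> / real n * (real (count x i) - 1))"

text \<open>The distribution of the new position of a particle chosen at \<open>i\<close>.\<close>

definition arw_target :: "('v, 'e) pre_digraph \<Rightarrow> real \<Rightarrow> nat \<Rightarrow> 'v multiset \<Rightarrow> 'v \<Rightarrow> 'v pmf" where
  "arw_target G \<beta> n x i = embed_pmf (\<lambda>j.
     if j = i then 1 / arw_Z G \<beta> n x i * exp (\<beta> / real n * (real (count x i) - 1))
     else if i \<rightarrow>\<^bsub>G\<^esub> j then 1 / arw_Z G \<beta> n x i * exp (\<beta> / real n * real (count x j))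
     else 0)"

lemma arw_Z_pos: "arw_Z G \<beta> n x i > 0"
  unfolding arw_Z_def by (intro add_nonneg_pos sum_nonneg) auto

lemma (in digraph) pmf_arw_target:
  "pmf (arw_target G \<beta> n x i) j =
     (if j = i then 1 / arw_Z G \<beta> n x i * exp (\<beta> / real n * (real (count x i) - 1))
      else if i \<rightarrow>\<^bsub>G\<^esub> j then 1 / arw_Z G \<beta> n x i * exp (\<beta> / real n * real (count x j))
      else 0)"
proof -
  define Z where "Z = arw_Z G \<beta> n x i"
  define f where "f = (\<lambda>j.
     if j = i then 1 / Z * exp (\<beta> / real n * (real (count x i) - 1))
     else if i \<rightarrow>\<^bsub>G\<^esub> j then 1 / Z * exp (\<beta> / real n * real (count x j))
     else 0)"
  have Z: "Z > 0"
    by (simp add: Z_def arw_Z_pos)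
  have nonneg: "f l \<ge> 0" for l
    using Z by (simp add: f_def)
  have fin: "finite {l. i \<rightarrow>\<^bsub>G\<^esub> l}"
    by (rule finite_subset[OF _ finite_verts]) (auto dest: adj_in_verts)
  have i: "i \<notin> {l. i \<rightarrow>\<^bsub>G\<^esub> l}"
    using no_loops by (auto simp: arcs_ends_conv)
  have "(\<integral>\<^sup>+ l. ennreal (f l) \<partial>count_space UNIV) =
        (\<integral>\<^sup>+ l. ennreal (f l) \<partial>count_space (insert i {l. i \<rightarrow>\<^bsub>G\<^esub> l}))"
    by (rule nn_integral_count_space_eq) (auto simp: f_def)
  also have "\<dots> = (\<Sum>l\<in>insert i {l. i \<rightarrow>\<^bsub>G\<^esub> l}. ennreal (f l))"
    using fin by (intro nn_integral_count_space_finite) simp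
  also have "\<dots> = ennreal (\<Sum>l\<in>insert i {l. i \<rightarrow>\<^bsub>G\<^esub> l}. f l)"
    by (intro sum_ennreal nonneg)
  also have "(\<Sum>l\<in>insert i {l. i \<rightarrow>\<^bsub>G\<^esub> l}. f l) = f i + (\<Sum>l | i \<rightarrow>\<^bsub>G\<^esub> l. f l)"
    using fin i by simp
  also have "(\<Sum>l | i \<rightarrow>\<^bsub>G\<^esub> l. f l) =
             (\<Sum>l | i \<rightarrow>\<^bsub>G\<^esub> l. 1 / Z * exp (\<beta> / real n * real (count x l)))"
    using i by (intro sum.cong) (auto simp: f_def)
  also have "f i + \<dots> = 1 / Z * Z"
    unfolding Z_def arw_Z_def f_def by (simp add: sum_distrib_left distrib_left add_ac)
  also have "\<dots> = 1"
    using Z by simp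
  finally have "(\<integral>\<^sup>+ l. ennreal (f l) \<partial>count_space UNIV) = 1"
    by simp
  then have "pmf (embed_pmf f) j = f j"
    by (intro pmf_embed_pmf nonneg)
  then show ?thesis
    unfolding f_def Z_def arw_target_def .
qed

text \<open>
  Drawing from \<open>pmf_of_multiset x\<close> is choosing one of the particles uniformly at
  random and recording its position.
\<close>

definition arw_kernel :: "('v, 'e) pre_digraph \<Rightarrow> real \<Rightarrow> nat \<Rightarrow> 'v multiset \<Rightarrow> 'v multiset pmf" where
  "arw_kernel G \<beta> n x =
     bind_pmf (pmf_of_multiset x) (\<lambda>i.
     bind_pmf (arw_target G \<beta> n x i) (\<lambda>j.
     return_pmf (x - {#i#} + {#j#})))"

definition arw_mixing_time :: "('v, 'e) pre_digraph \<Rightarrow> real \<Rightarrow> nat \<Rightarrow> enat" where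
  "arw_mixing_time G \<beta> n = mixing_time (arw_states G n) (arw_kernel G \<beta> n) (1/4)"

end

theory Submission
  imports Defs
begin

text \<open>
  Two configurations with \<open>n\<close> particles each are coupled by matching their particles up
  arbitrarily, choosing the same pair in both, and moving its two particles independently if they
  are at different vertices. All moves along edges and all lazy moves have probability
  bounded below, so the potential \<open>h(i, j) = 2 - 2 \<theta>^dist(i, j)\<close> of such a pair then drops by a constant
  \<open>\<gamma>\<close> on average when \<open>\<theta>\<close> is small. Two particles at the same vertex are moved by an almost maximal
  coupling: if \<open>D\<close> pairs are split, the two target distributions have ratio at least
  \<open>exp(-2\<beta>D/n)\<close>, and thus the pair splits with probability at most \<open>2\<beta>D/n\<close>. Summing over the
  \<open>D\<close> split and at most \<open>n\<close> joined pairs, the total potential falls on average by \<open>(\<gamma> - 4\<beta>)D/n\<close>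
  per step, which for \<open>\<beta> \<le> \<gamma>/8\<close> is a contraction by the factor \<open>1 - \<gamma>/(4n)\<close>.
\<close>

section \<open>Total variation distance and mixtures\<close>

lemma tv_dist_leI:
  assumes "\<And>A. \<bar>measure_pmf.prob \<mu> A - measure_pmf.prob \<nu> A\<bar> \<le> c"
  shows "tv_dist \<mu> \<nu> \<le> c"
  unfolding tv_dist_def by (rule cSUP_least) (use assms in auto)

lemma abs_prob_diff_le_tv_dist:
  "\<bar>measure_pmf.prob \<mu> A - measure_pmf.prob \<nu> A\<bar> \<le> tv_dist \<mu> \<nu>"
  unfolding tv_dist_def
proof (rule cSUP_upper)
  show "bdd_above (range (\<lambda>A. \<bar>measure_pmf.prob \<mu> A - measure_pmf.prob \<nu> A\<bar>))"
  proof (rule bdd_aboveI2[where M = 1])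
    fix A
    show "\<bar>measure_pmf.prob \<mu> A - measure_pmf.prob \<nu> A\<bar> \<le> 1"
      using measure_pmf.prob_le_1[of \<mu> A] measure_pmf.prob_le_1[of \<nu> A]
        measure_nonneg[of \<mu> A] measure_nonneg[of \<nu> A] by linarith
  qed
qed simp

text \<open>The coupling inequality: the preimages of an event under \<open>f\<close> and
  \<open>g\<close> agree outside the set where \<open>f\<close> and \<open>g\<close> differ.\<close>

lemma tv_dist_map_pmf_le:
  "tv_dist (map_pmf f M) (map_pmf g M) \<le> measure_pmf.prob M {z. f z \<noteq> g z}"
proof (rule tv_dist_leI)
  fix A
  let ?F = "f -` A" and ?G = "g -` A" and ?N = "{z. f z \<noteq> g z}"
  have "measure_pmf.prob M ?F \<le> measure_pmf.prob M (?G \<union> ?N)"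
       "measure_pmf.prob M ?G \<le> measure_pmf.prob M (?F \<union> ?N)"
    by (auto intro!: measure_pmf.finite_measure_mono)
  moreover have "measure_pmf.prob M (?G \<union> ?N) \<le> measure_pmf.prob M ?G + measure_pmf.prob M ?N"
       "measure_pmf.prob M (?F \<union> ?N) \<le> measure_pmf.prob M ?F + measure_pmf.prob M ?N"
    by (auto intro!: measure_Un_le)
  ultimately show "\<bar>measure_pmf.prob (map_pmf f M) A - measure_pmf.prob (map_pmf g M) A\<bar>
      \<le> measure_pmf.prob M ?N"
    by simp
qed

lemma prob_bind_pmf_eq_sum:
  assumes "finite S" "set_pmf \<mu> \<subseteq> S"
  shows "measure_pmf.prob (bind_pmf \<mu> F) A = (\<Sum>x\<in>S. pmf \<mu> x * measure_pmf.prob (F x) A)"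
proof -
  have "ennreal (measure_pmf.prob (bind_pmf \<mu> F) A) =
      (\<integral>\<^sup>+x. ennreal (measure_pmf.prob (F x) A) \<partial>\<mu>)"
    by (simp flip: measure_pmf.emeasure_eq_measure)
  also have "\<dots> = (\<Sum>x\<in>S. ennreal (measure_pmf.prob (F x) A) * pmf \<mu> x)"
    using assms by (intro nn_integral_measure_pmf_support) (auto simp: set_pmf_eq)
  also have "\<dots> = ennreal (\<Sum>x\<in>S. pmf \<mu> x * measure_pmf.prob (F x) A)"
    by (simp add: ennreal_mult'[symmetric] mult.commute)
  finally show ?thesis
    by (simp add: sum_nonneg)
qed

text \<open>The difference is the average of the differences for the single \<open>F x\<close>, with
  weights that sum to 1. The form with one event \<open>A\<close> also yields bounds on point
  masses, by taking singletons.\<close>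

lemma abs_prob_bind_pmf_diff_le:
  assumes "finite S" "set_pmf \<mu> \<subseteq> S"
    and "\<And>x. x \<in> S \<Longrightarrow> tv_dist (F x) \<nu> \<le> c"
  shows "\<bar>measure_pmf.prob (bind_pmf \<mu> F) A - measure_pmf.prob \<nu> A\<bar> \<le> c"
proof -
  have one: "(\<Sum>x\<in>S. pmf \<mu> x) = 1"
    using assms by (intro sum_pmf_eq_1)
  then have "measure_pmf.prob (bind_pmf \<mu> F) A - measure_pmf.prob \<nu> A =
      (\<Sum>x\<in>S. pmf \<mu> x * (measure_pmf.prob (F x) A - measure_pmf.prob \<nu> A))"
    using assms(1,2)
    by (simp add: prob_bind_pmf_eq_sum right_diff_distrib sum_subtractf flip: sum_distrib_right)
  also have "\<bar>\<dots>\<bar> \<le> (\<Sum>x\<in>S. pmf \<mu> x * c)"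
  proof (rule order_trans[OF sum_abs], rule sum_mono)
    fix x assume "x \<in> S"
    then have "\<bar>measure_pmf.prob (F x) A - measure_pmf.prob \<nu> A\<bar> \<le> c"
      using abs_prob_diff_le_tv_dist[of "F x" A \<nu>] assms(3)[of x] by linarith
    then show "\<bar>pmf \<mu> x * (measure_pmf.prob (F x) A - measure_pmf.prob \<nu> A)\<bar> \<le> pmf \<mu> x * c"
      by (simp add: abs_mult mult_left_mono)
  qed
  also have "\<dots> = c"
    using one by (simp flip: sum_distrib_right)
  finally show ?thesis .
qed

lemma tv_dist_bind_pmf_le:
  assumes "finite S" "set_pmf \<mu> \<subseteq> S" "\<And>x. x \<in> S \<Longrightarrow> tv_dist (F x) \<nu> \<le> c"
  shows "tv_dist (bind_pmf \<mu> F) \<nu> \<le> c"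
  using abs_prob_bind_pmf_diff_le[OF assms] by (rule tv_dist_leI)

lemma tv_dist_commute: "tv_dist \<mu> \<nu> = tv_dist \<nu> \<mu>"
  unfolding tv_dist_def by (simp add: abs_minus_commute)

section \<open>Powers of a kernel\<close>

lemma kernel_power_add:
  "kernel_power K (s + t) x = bind_pmf (kernel_power K s x) (kernel_power K t)"
  by (induction t) (simp_all add: bind_return_pmf' bind_assoc_pmf)

lemma set_kernel_power:
  assumes "\<And>x. x \<in> S \<Longrightarrow> set_pmf (K x) \<subseteq> S" "x \<in> S"
  shows "set_pmf (kernel_power K t x) \<subseteq> S"
  using assms by (induction t) auto

lemma bind_kernel_power_stationary:
  assumes "bind_pmf \<pi> K = \<pi>"
  shows "bind_pmf \<pi> (kernel_power K t) = \<pi>"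
proof (induction t)
  case (Suc t)
  have "bind_pmf \<pi> (kernel_power K (Suc t)) = bind_pmf (bind_pmf \<pi> (kernel_power K t)) K"
    by (auto simp: bind_assoc_pmf intro: bind_pmf_cong)
  also have "\<dots> = \<pi>"
    using Suc assms by simp
  finally show ?case .
qed (simp add: bind_return_pmf')

lemma pmf_bind_eq_sum:
  assumes "finite S" "set_pmf \<mu> \<subseteq> S"
  shows "pmf (bind_pmf \<mu> F) y = (\<Sum>x\<in>S. pmf \<mu> x * pmf (F x) y)"
  using prob_bind_pmf_eq_sum[OF assms, of F "{y}"] by (simp add: measure_pmf_single)

section \<open>Stationary distribution of a finite chain whose rows merge\<close>

context
  fixes S :: "'s set" and K :: "'s \<Rightarrow> 's pmf" and e :: "nat \<Rightarrow> real"
  assumes finite: "finite S" and nonempty: "S \<noteq> {}"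
    and closed: "\<And>x. x \<in> S \<Longrightarrow> set_pmf (K x) \<subseteq> S"
    and tv: "\<And>x y t. x \<in> S \<Longrightarrow> y \<in> S \<Longrightarrow> tv_dist (kernel_power K t x) (kernel_power K t y) \<le> e t"
    and e: "e \<longlonglongrightarrow> 0"
begin

text \<open>By invariance \<open>\<pi>\<close> is a mixture of the rows at time \<open>t\<close>,
  and each of these is within \<open>e t\<close> of the row of \<open>x\<close>.\<close>

lemma tv_dist_stationary_le:
  assumes "is_stationary S K \<pi>" "x \<in> S"
  shows "tv_dist (kernel_power K t x) \<pi> \<le> e t"
proof -
  have "tv_dist (bind_pmf \<pi> (kernel_power K t)) (kernel_power K t x) \<le> e t"
    using assms tv by (intro tv_dist_bind_pmf_le[OF finite]) (auto simp: is_stationary_def)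
  then show ?thesis
    using assms by (simp add: bind_kernel_power_stationary is_stationary_def tv_dist_commute)
qed

text \<open>The row of \<open>x\<close> at time \<open>s + t\<close> is a mixture of rows at time
  \<open>t\<close>, hence within \<open>e t\<close> of the row of \<open>x\<close> at time
  \<open>t\<close>, uniformly in \<open>s\<close>. So the point masses form a Cauchy
  sequence.\<close>

lemma convergent_kernel_power:
  assumes "x \<in> S"
  shows "convergent (\<lambda>t. pmf (kernel_power K t x) y)"
proof -
  have *: "\<bar>pmf (kernel_power K (s + t) x) y - pmf (kernel_power K t x) y\<bar> \<le> e t" for s t
    using abs_prob_bind_pmf_diff_le[of S "kernel_power K s x" "kernel_power K t"
        "kernel_power K t x" "e t" "{y}"] finite set_kernel_power[of S K x s] closed tv assms
    by (simp add: kernel_power_add measure_pmf_single)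
  have "Cauchy (\<lambda>t. pmf (kernel_power K t x) y)"
  proof (rule CauchyI')
    fix r :: real assume "r > 0"
    then have "eventually (\<lambda>t. e t < r) sequentially"
      using e order_tendstoD(2) by blast
    then obtain M where M: "\<And>t. t \<ge> M \<Longrightarrow> e t < r"
      by (auto simp: eventually_sequentially)
    show "\<exists>M. \<forall>m\<ge>M. \<forall>n>m. dist (pmf (kernel_power K m x) y) (pmf (kernel_power K n x) y) < r"
    proof (intro exI[of _ M] allI impI)
      fix m n assume "m \<ge> M" "n > m"
      then show "dist (pmf (kernel_power K m x) y) (pmf (kernel_power K n x) y) < r"
        using *[of "n - m" m] M[of m] by (simp add: dist_real_def abs_minus_commute)
    qed
  qed
  then show ?thesis
    by (rule Cauchy_convergent)
qed

text \<open>The limit of the rows from any fixed start is stationary: since \<open>S\<close> is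
  finite, limits commute with sums over \<open>S\<close>, so the limit has mass 1 and inherits the
  one-step recursion.\<close>

lemma ex_stationary: "\<exists>\<pi>. is_stationary S K \<pi>"
proof -
  obtain x where x: "x \<in> S"
    using nonempty by blast
  define P where "P = (\<lambda>t. pmf (kernel_power K t x))"
  have P_set: "set_pmf (kernel_power K t x) \<subseteq> S" for t
    using set_kernel_power[OF closed x] .
  define L where "L = (\<lambda>y. lim (\<lambda>t. P t y))"
  have L: "(\<lambda>t. P t y) \<longlonglongrightarrow> L y" for y
    unfolding L_def P_def using convergent_kernel_power[OF x] by (simp add: convergent_LIMSEQ_iff)
  have L0: "L y \<ge> 0" for y
    using L by (rule LIMSEQ_le_const) (auto simp: P_def)
  have L_outside: "L y = 0" if "y \<notin> S" for y
  proof -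
    have "(\<lambda>t. P t y) = (\<lambda>_. 0)"
      using P_set that by (force simp: P_def pmf_eq_0_set_pmf)
    then show ?thesis
      using L[of y] by (simp add: LIMSEQ_const_iff)
  qed
  have "(\<lambda>t. \<Sum>y\<in>S. P t y) \<longlonglongrightarrow> (\<Sum>y\<in>S. L y)"
    by (intro tendsto_sum L)
  moreover have "(\<Sum>y\<in>S. P t y) = 1" for t
    unfolding P_def using finite P_set by (rule sum_pmf_eq_1)
  ultimately have L1: "(\<Sum>y\<in>S. L y) = 1"
    by (simp add: LIMSEQ_const_iff)
  have "(\<integral>\<^sup>+ y. ennreal (L y) \<partial>count_space UNIV) = (\<integral>\<^sup>+ y. ennreal (L y) \<partial>count_space S)"
    by (rule nn_integral_count_space_eq) (auto simp: L_outside)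
  also have "\<dots> = 1"
    using finite by (simp add: nn_integral_count_space_finite L0 L1 sum_ennreal)
  finally have pmf: "pmf (embed_pmf L) y = L y" for y
    by (intro pmf_embed_pmf L0)
  have sub: "set_pmf (embed_pmf L) \<subseteq> S"
    using L_outside by (auto simp: set_pmf_eq pmf)
  have "bind_pmf (embed_pmf L) K = embed_pmf L"
  proof (rule pmf_eqI)
    fix y
    have "(\<lambda>t. \<Sum>x\<in>S. P t x * pmf (K x) y) \<longlonglongrightarrow> (\<Sum>x\<in>S. L x * pmf (K x) y)"
      by (intro tendsto_intros L)
    also have "(\<lambda>t. \<Sum>x\<in>S. P t x * pmf (K x) y) = (\<lambda>t. P (Suc t) y)"
      unfolding P_def using finite P_set by (simp add: pmf_bind_eq_sum)
    finally have "L y = (\<Sum>x\<in>S. L x * pmf (K x) y)"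
      using LIMSEQ_Suc[OF L] LIMSEQ_unique by blast
    then show "pmf (bind_pmf (embed_pmf L) K) y = pmf (embed_pmf L) y"
      using finite sub by (simp add: pmf_bind_eq_sum pmf)
  qed
  with sub show ?thesis
    by (auto simp: is_stationary_def)
qed

text \<open>Every stationary distribution is the limit of the same sequence of rows.\<close>

lemma stationary_unique:
  assumes "is_stationary S K \<pi>" "is_stationary S K \<pi>'"
  shows "\<pi> = \<pi>'"
proof (rule pmf_eqI)
  fix y
  obtain x where x: "x \<in> S"
    using nonempty by blast
  have "(\<lambda>t. pmf (kernel_power K t x) y) \<longlonglongrightarrow> pmf \<rho> y" if "is_stationary S K \<rho>" for \<rho>
  proof (rule LIMSEQ_I)
    fix r :: real assume "r > 0"
    then have "eventually (\<lambda>t. e t < r) sequentially"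
      using e order_tendstoD(2) by blast
    then obtain M where M: "\<And>t. t \<ge> M \<Longrightarrow> e t < r"
      by (auto simp: eventually_sequentially)
    show "\<exists>M. \<forall>t\<ge>M. norm (pmf (kernel_power K t x) y - pmf \<rho> y) < r"
    proof (intro exI[of _ M] allI impI)
      fix t assume "t \<ge> M"
      then show "norm (pmf (kernel_power K t x) y - pmf \<rho> y) < r"
        using abs_prob_diff_le_tv_dist[of "kernel_power K t x" "{y}" \<rho>]
          tv_dist_stationary_le[OF that x, of t] M[of t]
        by (simp add: measure_pmf_single)
    qed
  qed
  then show "pmf \<pi> y = pmf \<pi>' y"
    using assms LIMSEQ_unique by blast
qed

text \<open>Existence and uniqueness make the \<open>THE\<close> in \<open>stationary_pmf\<close>
  denote an actual stationary distribution, so the bound on the distance to stationarity applies to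
  it.\<close>

lemma mixing_dist_le: "mixing_dist S K t \<le> e t"
proof -
  have "is_stationary S K (stationary_pmf S K)"
    unfolding stationary_pmf_def using ex_stationary stationary_unique by (metis theI)
  then show ?thesis
    unfolding mixing_dist_def using finite nonempty tv_dist_stationary_le by simp
qed

end

section \<open>Couplings of Markov chains\<close>

text \<open>The coupled chain never leaves \<open>Z\<close>, and on \<open>Z\<close> the projection
  \<open>f\<close> turns a step of \<open>W\<close> into a step of \<open>K\<close>.\<close>

lemma coupling_kernel_power:
  assumes "\<And>z. z \<in> Z \<Longrightarrow> map_pmf f (W z) = K (f z)" "\<And>z. z \<in> Z \<Longrightarrow> set_pmf (W z) \<subseteq> Z" "z \<in> Z"
  shows "map_pmf f (kernel_power W t z) = kernel_power K t (f z)"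
proof (induction t)
  case (Suc t)
  have "map_pmf f (kernel_power W (Suc t) z) = bind_pmf (kernel_power W t z) (\<lambda>z. K (f z))"
    using set_kernel_power[of Z W z t, OF assms(2,3)] assms(1)
    by (auto simp: map_bind_pmf intro!: bind_pmf_cong)
  then show ?case
    using Suc by (simp add: bind_map_pmf flip: Suc)
qed simp

text \<open>The one-step contraction is iterated along the invariant set \<open>Z\<close>. Values in
  \<open>ennreal\<close> avoid integrability conditions.\<close>

lemma nn_integral_kernel_power_le:
  fixes \<Phi> :: "'c \<Rightarrow> ennreal" and W :: "'c \<Rightarrow> 'c pmf"
  assumes "\<And>z. z \<in> Z \<Longrightarrow> (\<integral>\<^sup>+z'. \<Phi> z' \<partial>W z) \<le> r * \<Phi> z"
    and "\<And>z. z \<in> Z \<Longrightarrow> set_pmf (W z) \<subseteq> Z" and "z \<in> Z"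
  shows "(\<integral>\<^sup>+z'. \<Phi> z' \<partial>kernel_power W t z) \<le> r ^ t * \<Phi> z"
proof (induction t)
  case (Suc t)
  have "(\<integral>\<^sup>+z'. \<Phi> z' \<partial>kernel_power W (Suc t) z) \<le> (\<integral>\<^sup>+z'. r * \<Phi> z' \<partial>kernel_power W t z)"
    using set_kernel_power[of Z W z t, OF assms(2,3)] assms(1)
    unfolding kernel_power.simps nn_integral_bind_pmf
    by (intro nn_integral_mono_AE) (auto simp: AE_measure_pmf_iff)
  also have "\<dots> = r * (\<integral>\<^sup>+z'. \<Phi> z' \<partial>kernel_power W t z)"
    by (rule nn_integral_cmult) simp
  also have "\<dots> \<le> r * (r ^ t * \<Phi> z)"
    by (intro mult_left_mono Suc) simp
  finally show ?case
    by (simp add: mult.assoc)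
qed simp

text \<open>The coupling inequality followed by Markov's inequality: \<open>\<Phi>\<close> dominates
  the indicator of disagreement, and its expectation decays like \<open>r ^ t\<close>.\<close>

lemma tv_dist_kernel_power_coupling:
  fixes \<Phi> :: "'c \<Rightarrow> real" and W :: "'c \<Rightarrow> 'c pmf"
  assumes f: "\<And>z. z \<in> Z \<Longrightarrow> map_pmf f (W z) = K (f z)"
    and g: "\<And>z. z \<in> Z \<Longrightarrow> map_pmf g (W z) = K (g z)"
    and Z: "\<And>z. z \<in> Z \<Longrightarrow> set_pmf (W z) \<subseteq> Z" "z \<in> Z"
    and \<Phi>: "\<And>z. \<Phi> z \<ge> 0" "\<And>z. f z \<noteq> g z \<Longrightarrow> \<Phi> z \<ge> 1"
    and r: "r \<ge> 0" "\<And>z. z \<in> Z \<Longrightarrow> (\<integral>\<^sup>+z'. ennreal (\<Phi> z') \<partial>W z) \<le> ennreal (r * \<Phi> z)"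
  shows "tv_dist (kernel_power K t (f z)) (kernel_power K t (g z)) \<le> r ^ t * \<Phi> z"
proof -
  let ?M = "kernel_power W t z"
  have "ennreal (measure_pmf.prob ?M {z. f z \<noteq> g z}) = (\<integral>\<^sup>+z. indicator {z. f z \<noteq> g z} z \<partial>?M)"
    by (simp add: measure_pmf.emeasure_eq_measure)
  also have "\<dots> \<le> (\<integral>\<^sup>+z. ennreal (\<Phi> z) \<partial>?M)"
    using \<Phi> by (intro nn_integral_mono) (auto simp: indicator_def simp flip: ennreal_1)
  also have "\<dots> \<le> ennreal r ^ t * ennreal (\<Phi> z)"
    using r \<Phi> Z by (intro nn_integral_kernel_power_le[of Z]) (auto simp: ennreal_mult)
  also have "\<dots> = ennreal (r ^ t * \<Phi> z)"
    using r(1) \<Phi>(1) by (simp add: ennreal_power ennreal_mult)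
  finally have "measure_pmf.prob ?M {z. f z \<noteq> g z} \<le> r ^ t * \<Phi> z"
    using r(1) \<Phi>(1) by simp
  then show ?thesis
    using tv_dist_map_pmf_le[of f ?M g] coupling_kernel_power[of Z f W K z t, OF f Z]
      coupling_kernel_power[of Z g W K z t, OF g Z] by simp
qed

section \<open>Coupling two distributions with bounded ratio\<close>

text \<open>The law \<open>q\<close> is a mixture of \<open>p\<close> with weight
  \<open>1 - \<delta>\<close> and a residual law \<open>s\<close> with weight
  \<open>\<delta>\<close>, so both coordinates can share the draw from \<open>p\<close> in the first
  case.\<close>

lemma minorized_coupling:
  fixes p q :: "'s pmf"
  assumes "0 \<le> \<delta>" "\<delta> \<le> 1" and q: "\<And>a. (1 - \<delta>) * pmf p a \<le> pmf q a"
  obtains c where "map_pmf fst c = p" "map_pmf snd c = q"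
    "measure_pmf.prob c {a. fst a \<noteq> snd a} \<le> \<delta>"
proof -
  define s where "s = (\<lambda>a. (pmf q a - (1 - \<delta>) * pmf p a) / \<delta>)"
  \<comment> \<open>For \<open>\<delta> = 0\<close> the pmf \<open>embed_pmf s\<close> is junk, but it is then used with weight \<open>0\<close>.\<close>
  have mix: "pmf q a = (1 - \<delta>) * pmf p a + \<delta> * pmf (embed_pmf s) a" for a
  proof (cases "\<delta> = 0")
    case True
    have "pmf p a \<le> pmf q a" for a
      using q[of a] True by simp
    then have "p = q"
      using pmf_neq_exists_less[of q p] by (metis linorder_not_le)
    then show ?thesis
      using True by simp
  next
    case False
    with assms(1) have \<delta>: "\<delta> > 0"
      by simp
    have s0: "s a \<ge> 0" for a
      using q[of a] \<delta> by (simp add: s_def)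
    have int: "integrable (count_space UNIV) (pmf p)" "integrable (count_space UNIV) (pmf q)"
      by (auto intro: integrable_pmf)
    then have s_int: "integrable (count_space UNIV) s"
      unfolding s_def by auto
    have "(\<integral>a. s a \<partial>count_space UNIV) = (1 - (1 - \<delta>) * 1) / \<delta>"
      unfolding s_def using int by (simp add: integral_pmf)
    also have "\<dots> = 1"
      using \<delta> by simp
    finally have "(\<integral>\<^sup>+a. ennreal (s a) \<partial>count_space UNIV) = 1"
      using s0 s_int by (simp add: nn_integral_eq_integral)
    then have "pmf (embed_pmf s) a = s a"
      by (intro pmf_embed_pmf s0)
    then show ?thesis
      using \<delta> by (simp add: s_def)
  qed
  \<comment> \<open>The coin decides whether the second coordinate is drawn from the residual law or
    copied from the first; the first coordinate has law \<open>p\<close> in either case.\<close>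
  define c where "c = bind_pmf (bernoulli_pmf \<delta>)
      (\<lambda>b. if b then pair_pmf p (embed_pmf s) else map_pmf (\<lambda>a. (a, a)) p)"
  have "map_pmf fst c = p"
    unfolding c_def map_bind_pmf by (simp add: if_distrib map_fst_pair_pmf pmf.map_comp o_def cong: if_cong)
  moreover have "map_pmf snd c = q"
  proof (rule pmf_eqI)
    fix a
    have "map_pmf snd c = bind_pmf (bernoulli_pmf \<delta>) (\<lambda>b. if b then embed_pmf s else p)"
      unfolding c_def map_bind_pmf
      by (simp add: if_distrib map_snd_pair_pmf pmf.map_comp o_def cong: if_cong)
    then show "pmf (map_pmf snd c) a = pmf q a"
      using assms(1,2) by (simp add: pmf_bind mix)
  qed
  moreover have "measure_pmf.prob c {a. fst a \<noteq> snd a} \<le> \<delta>"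
  proof -
    have "measure_pmf.prob c {a. fst a \<noteq> snd a} =
        (\<Sum>b\<in>UNIV. pmf (bernoulli_pmf \<delta>) b * measure_pmf.prob
          (if b then pair_pmf p (embed_pmf s) else map_pmf (\<lambda>a. (a, a)) p) {a. fst a \<noteq> snd a})"
      unfolding c_def by (rule prob_bind_pmf_eq_sum) auto
    also have "\<dots> = \<delta> * measure_pmf.prob (pair_pmf p (embed_pmf s)) {a. fst a \<noteq> snd a}"
      using assms(1,2) by (simp add: UNIV_bool vimage_def)
    also have "\<dots> \<le> \<delta>"
      using assms(1) by (simp add: mult_left_le)
    finally show ?thesis .
  qed
  ultimately show ?thesis
    by (rule that)
qed

lemma finite_set_pmf_coupling:
  assumes "finite (set_pmf (map_pmf fst c))" "finite (set_pmf (map_pmf snd c))"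
  shows "finite (set_pmf c)"
proof (rule finite_subset)
  show "set_pmf c \<subseteq> set_pmf (map_pmf fst c) \<times> set_pmf (map_pmf snd c)"
    by force
qed (use assms in auto)

section \<open>Chains that replace one random element of a multiset\<close>

lemma map_pmf_of_multiset:
  assumes "z \<noteq> {#}"
  shows "map_pmf f (pmf_of_multiset z) = pmf_of_multiset (image_mset f z)"
proof (rule pmf_eqI)
  fix x
  have "pmf (map_pmf f (pmf_of_multiset z)) x =
      measure_pmf.prob (pmf_of_multiset z) (f -` {x} \<inter> set_mset z)"
    using assms measure_Int_set_pmf[of "pmf_of_multiset z" "f -` {x}"] by (simp add: pmf_map)
  also have "\<dots> = (\<Sum>a\<in>f -` {x} \<inter> set_mset z. real (count z a) / real (size z))"
    using assms by (subst measure_measure_pmf_finite) auto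
  also have "\<dots> = pmf (pmf_of_multiset (image_mset f z)) x"
    using assms by (simp add: count_image_mset flip: sum_divide_distrib)
  finally show "pmf (map_pmf f (pmf_of_multiset z)) x = pmf (pmf_of_multiset (image_mset f z)) x" .
qed

text \<open>The common form of the ARW chain, on multisets of vertices, and of its coupling, on
  multisets of pairs. The law of the new element may depend on the whole multiset.\<close>

definition replacement_kernel :: "('a multiset \<Rightarrow> 'a \<Rightarrow> 'a pmf) \<Rightarrow> 'a multiset \<Rightarrow> 'a multiset pmf" where
  "replacement_kernel C z =
     bind_pmf (pmf_of_multiset z) (\<lambda>a. map_pmf (\<lambda>b. z - {#a#} + {#b#}) (C z a))"

lemma arw_kernel_eq_replacement_kernel:
  "arw_kernel G \<beta> n = replacement_kernel (arw_target G \<beta> n)"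
  by (simp add: fun_eq_iff arw_kernel_def replacement_kernel_def map_pmf_def)

text \<open>With \<open>fst\<close> and \<open>snd\<close> for \<open>f\<close>, this makes a chain
  on multisets of pairs a coupling of two ARW chains: a uniform pair projects to a uniform particle,
  and removing a present element commutes with taking images.\<close>

lemma map_replacement_kernel:
  assumes "z \<noteq> {#}" and "\<And>a. a \<in># z \<Longrightarrow> map_pmf f (C z a) = T (image_mset f z) (f a)"
  shows "map_pmf (image_mset f) (replacement_kernel C z) = replacement_kernel T (image_mset f z)"
proof -
  let ?x = "image_mset f z"
  have "map_pmf (image_mset f) (replacement_kernel C z) =
      bind_pmf (pmf_of_multiset z) (\<lambda>a. map_pmf (\<lambda>b. ?x - {#f a#} + {#b#}) (T ?x (f a)))"
    unfolding replacement_kernel_def map_bind_pmf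
  proof (rule bind_pmf_cong[OF refl])
    fix a assume "a \<in> set_pmf (pmf_of_multiset z)"
    then have a: "a \<in># z"
      using assms(1) by simp
    then show "map_pmf (image_mset f) (map_pmf (\<lambda>b. z - {#a#} + {#b#}) (C z a)) =
        map_pmf (\<lambda>b. ?x - {#f a#} + {#b#}) (T ?x (f a))"
      by (simp add: pmf.map_comp o_def image_mset_Diff flip: assms(2))
  qed
  also have "\<dots> = replacement_kernel T ?x"
    using assms(1) by (simp add: replacement_kernel_def bind_map_pmf flip: map_pmf_of_multiset)
  finally show ?thesis .
qed

lemma set_replacement_kernel:
  assumes "z \<noteq> {#}" "z' \<in> set_pmf (replacement_kernel C z)"
  obtains a b where "a \<in># z" "b \<in> set_pmf (C z a)" "z' = z - {#a#} + {#b#}"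
  using assms unfolding replacement_kernel_def by auto

lemma sum_mset_eq_sum_count:
  fixes h :: "'a \<Rightarrow> real"
  shows "(\<Sum>a\<in>#z. h a) = (\<Sum>a\<in>set_mset z. real (count z a) * h a)"
proof (induction z)
  case (add x z)
  have "(\<Sum>a\<in>set_mset (add_mset x z). real (count (add_mset x z) a) * h a) =
      (\<Sum>a\<in>set_mset (add_mset x z). real (count z a) * h a + (if a = x then h a else 0))"
    by (intro sum.cong) (auto simp: algebra_simps)
  also have "\<dots> = (\<Sum>a\<in>set_mset (add_mset x z). real (count z a) * h a) + h x"
    by (simp add: sum.distrib sum.delta)
  also have "(\<Sum>a\<in>set_mset (add_mset x z). real (count z a) * h a) =
      (\<Sum>a\<in>set_mset z. real (count z a) * h a)"
    by (rule sum.mono_neutral_right) (auto simp: not_in_iff)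
  finally show ?case
    using add by simp
qed simp

text \<open>A step changes one summand, chosen uniformly, so the expected change of the sum is the
  average of the local changes, each at most \<open>- c a\<close>.\<close>

lemma nn_integral_replacement_kernel_le:
  fixes h c :: "'a \<Rightarrow> real"
  assumes "z \<noteq> {#}" and h: "\<And>a. h a \<ge> 0"
    and fin: "\<And>a. a \<in># z \<Longrightarrow> finite (set_pmf (C z a))"
    and drift: "\<And>a. a \<in># z \<Longrightarrow> measure_pmf.expectation (C z a) h \<le> h a - c a"
  shows "(\<integral>\<^sup>+z'. ennreal (\<Sum>a\<in>#z'. h a) \<partial>replacement_kernel C z) \<le>
    ennreal ((\<Sum>a\<in>#z. h a) - (\<Sum>a\<in>#z. c a) / real (size z))"
proof -
  define \<Phi> where "\<Phi> = (\<lambda>z. \<Sum>a\<in>#z. h a)"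
  let ?n = "real (size z)"
  have n: "?n > 0"
    using assms(1) by (simp add: nonempty_has_size)
  have sum_diff: "(\<Sum>a\<in>#z. u - c a) = real (size z) * u - (\<Sum>a\<in>#z. c a)" for u z
    by (induction z) (simp_all add: algebra_simps)
  have \<Phi>0: "\<Phi> z \<ge> 0" for z
    unfolding \<Phi>_def using h by (induction z) auto
  have "finite (set_pmf (replacement_kernel C z))"
    unfolding replacement_kernel_def using fin assms(1) by auto
  then have "(\<integral>\<^sup>+z'. ennreal (\<Phi> z') \<partial>replacement_kernel C z) =
      ennreal (measure_pmf.expectation (replacement_kernel C z) \<Phi>)"
    by (intro nn_integral_eq_integral integrable_measure_pmf_finite) (auto simp: \<Phi>0)
  also have "measure_pmf.expectation (replacement_kernel C z) \<Phi> =
      (\<Sum>a\<in>set_mset z. real (count z a) / ?n *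
        measure_pmf.expectation (C z a) (\<lambda>b. \<Phi> (z - {#a#} + {#b#})))"
    unfolding replacement_kernel_def
    by (subst pmf_expectation_bind[of "set_mset z"]) (use fin assms(1) in auto)
  also have "\<dots> \<le> (\<Sum>a\<in>set_mset z. real (count z a) / ?n * (\<Phi> z - c a))"
  proof (intro sum_mono mult_left_mono)
    fix a assume a: "a \<in># z"
    have "\<Phi> (z - {#a#} + {#b#}) = \<Phi> z - h a + h b" for b
      unfolding \<Phi>_def using a by (simp add: image_mset_Diff sum_mset_diff)
    moreover have "integrable (C z a) h"
      using fin[OF a] by (rule integrable_measure_pmf_finite)
    ultimately have "measure_pmf.expectation (C z a) (\<lambda>b. \<Phi> (z - {#a#} + {#b#})) =
        \<Phi> z - h a + measure_pmf.expectation (C z a) h"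
      by simp
    then show "measure_pmf.expectation (C z a) (\<lambda>b. \<Phi> (z - {#a#} + {#b#})) \<le> \<Phi> z - c a"
      using drift[OF a] by simp
  qed (use n in simp)
  also have "\<dots> = (\<Sum>a\<in>#z. \<Phi> z - c a) / ?n"
    by (simp add: sum_mset_eq_sum_count sum_divide_distrib)
  also have "(\<Sum>a\<in>#z. \<Phi> z - c a) = ?n * \<Phi> z - (\<Sum>a\<in>#z. c a)"
    by (rule sum_diff)
  also have "\<dots> / ?n = \<Phi> z - (\<Sum>a\<in>#z. c a) / ?n"
    using assms(1) by (simp add: diff_divide_distrib)
  finally show ?thesis
    by (simp add: \<Phi>_def ennreal_leI)
qed

text \<open>A pair with equal components contributes equally to both counts, any other pair changes
  their difference by at most 1.\<close>

lemma abs_count_image_mset_diff_le: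
  "\<bar>real (count (image_mset fst z) l) - real (count (image_mset snd z) l)\<bar>
    \<le> real (size {#a \<in># z. fst a \<noteq> snd a#})"
  by (induction z) auto

text \<open>Both multisets are listed in arbitrary order and zipped.\<close>

lemma ex_pairing:
  assumes "size x = size y"
  obtains z where "image_mset fst z = x" "image_mset snd z = y"
proof -
  obtain xs ys where "x = mset xs" "y = mset ys"
    using ex_mset by metis
  with assms have "image_mset fst (mset (zip xs ys)) = x" "image_mset snd (mset (zip xs ys)) = y"
    by (simp_all flip: mset_map)
  then show ?thesis
    by (rule that)
qed

section \<open>Estimates for the target distribution\<close>

context graph
begin

lemma finite_neighbours: "finite {l. i \<rightarrow> l}"
  by (rule finite_subset[OF _ finite_verts]) (auto dest: adj_in_verts)

lemma set_arw_target:
  assumes "i \<in> verts G"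
  shows "set_pmf (arw_target G \<beta> n x i) \<subseteq> verts G"
  using assms by (auto simp: set_pmf_eq pmf_arw_target split: if_splits dest: adj_in_verts)

lemma finite_set_arw_target: "finite (set_pmf (arw_target G \<beta> n x i))"
  by (rule finite_subset[of _ "insert i {l. i \<rightarrow> l}"])
    (auto simp: set_pmf_eq pmf_arw_target finite_neighbours split: if_splits)

text \<open>All exponents lie between 0 and 1, the one for staying because \<open>i\<close> is
  occupied. So every weight is at least 1, and \<open>arw_Z\<close> is a sum of at most
  \<open>card (verts G)\<close> terms, each at most \<open>exp 1\<close>.\<close>

lemma pmf_arw_target_ge:
  assumes x: "x \<in> arw_states G n" "i \<in># x" and \<beta>: "0 \<le> \<beta>" "\<beta> \<le> 1" and j: "j = i \<or> i \<rightarrow> j"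
  shows "pmf (arw_target G \<beta> n x i) j \<ge> 1 / (real (card (verts G)) * exp 1)"
proof -
  have n: "size x = n" "n > 0" and i: "i \<in> verts G"
    using x by (auto simp: arw_states_def gr0_conv_Suc size_eq_Suc_imp_eq_union dest: multi_member_split)
  have cnt: "count x l \<le> n" for l
    using n count_le_size[of x l] by simp
  have cnt_less: "real (count x i) - 1 \<le> real n"
    using cnt[of i] by linarith
  have ci: "count x i \<ge> 1"
    using x by (simp add: Suc_le_eq)
  have le1: "\<beta> / real n * a \<le> 1" if "a \<le> real n" for a
  proof -
    have "\<beta> * a \<le> \<beta> * real n" "\<beta> * real n \<le> 1 * real n"
      using \<beta> that by (intro mult_left_mono mult_right_mono; simp)+
    then have "\<beta> * a \<le> real n"
      by linarith
    then show ?thesis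
      using n by (simp add: divide_le_eq)
  qed
  have ge0: "\<beta> / real n * a \<ge> 0" if "a \<ge> 0" for a
    using \<beta> that by simp
  have loop: "i \<notin> {l. i \<rightarrow> l}"
    using no_loops by (auto simp: arcs_ends_conv)
  have "arw_Z G \<beta> n x i \<le> (\<Sum>l | i \<rightarrow> l. exp 1) + exp 1"
    unfolding arw_Z_def using cnt cnt_less
    by (intro add_mono sum_mono) (auto simp only: exp_le_cancel_iff of_nat_le_iff intro!: le1)
  also have "\<dots> = real (card (insert i {l. i \<rightarrow> l})) * exp 1"
    using finite_neighbours loop by (simp add: algebra_simps)
  also have "\<dots> \<le> real (card (verts G)) * exp 1"
    using i by (intro mult_right_mono of_nat_mono card_mono) (auto dest: adj_in_verts)
  finally have Z: "arw_Z G \<beta> n x i \<le> real (card (verts G)) * exp 1" .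
  have "1 / (real (card (verts G)) * exp 1) \<le> 1 / arw_Z G \<beta> n x i * 1"
    using Z arw_Z_pos[of G \<beta> n x i] by (simp add: frac_le)
  also have "\<dots> \<le> pmf (arw_target G \<beta> n x i) j"
  proof -
    have "exp (\<beta> / real n * (real (count x i) - 1)) \<ge> 1"
      using ge0[of "real (count x i) - 1"] ci by simp
    moreover have "exp (\<beta> / real n * real (count x j)) \<ge> 1"
      using ge0[of "real (count x j)"] by simp
    ultimately show ?thesis
      using j arw_Z_pos[of G \<beta> n x i] by (auto simp: pmf_arw_target divide_right_mono)
  qed
  finally show ?thesis .
qed

text \<open>Passing from \<open>x\<close> to \<open>y\<close> changes every weight, and hence also
  \<open>arw_Z\<close>, by a factor of at most \<open>exp (\<beta> * D / n)\<close> either way.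
  Numerator and denominator together account for the 2.\<close>

lemma pmf_arw_target_ratio:
  assumes D: "\<And>l. \<bar>real (count x l) - real (count y l)\<bar> \<le> D" and \<beta>: "0 \<le> \<beta>"
  shows "(1 - 2 * \<beta> * D / real n) * pmf (arw_target G \<beta> n x i) j \<le> pmf (arw_target G \<beta> n y i) j"
proof -
  define s where "s = \<beta> / real n"
  have s: "s \<ge> 0"
    using \<beta> by (simp add: s_def)
  \<comment> \<open>The shift \<open>a\<close> treats both kinds of weights at once: it is 0 for a
    neighbour and 1 for the current vertex.\<close>
  have cmp: "exp (s * (real (count x' l) - a)) \<le> exp (s * D) * exp (s * (real (count y' l) - a))"
    if "\<And>l. \<bar>real (count x' l) - real (count y' l)\<bar> \<le> D" for a l x' y'
  proof -
    have "s * (real (count x' l) - a) \<le> s * (D + (real (count y' l) - a))"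
      using s that[of l] by (intro mult_left_mono) auto
    then show ?thesis
      by (simp add: distrib_left flip: exp_add)
  qed
  have xy: "exp (s * (real (count x l) - a)) \<le> exp (s * D) * exp (s * (real (count y l) - a))"
    and yx: "exp (s * (real (count y l) - a)) \<le> exp (s * D) * exp (s * (real (count x l) - a))"
    for a l
    using D by (auto intro!: cmp simp: abs_minus_commute)
  have Z: "arw_Z G \<beta> n y i \<le> exp (s * D) * arw_Z G \<beta> n x i"
    unfolding arw_Z_def s_def[symmetric] distrib_left sum_distrib_left
    using yx[of _ 0] by (intro add_mono sum_mono yx) auto
  have quot: "exp (- 2 * s * D) * (1 / arw_Z G \<beta> n x i * u) \<le> 1 / arw_Z G \<beta> n y i * v"
    if "u \<le> exp (s * D) * v" "u \<ge> 0" for u v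
  proof -
    have "u * arw_Z G \<beta> n y i \<le> (exp (s * D) * v) * (exp (s * D) * arw_Z G \<beta> n x i)"
      using that Z arw_Z_pos[of G \<beta> n y i] by (intro mult_mono) (auto intro: order_trans)
    then have "exp (- 2 * s * D) * (u * arw_Z G \<beta> n y i) \<le>
        exp (- 2 * s * D) * ((exp (s * D) * v) * (exp (s * D) * arw_Z G \<beta> n x i))"
      by (intro mult_left_mono) auto
    also have "\<dots> = (exp (- 2 * s * D) * exp (s * D) * exp (s * D)) * (v * arw_Z G \<beta> n x i)"
      by (simp only: mult_ac)
    also have "exp (- 2 * s * D) * exp (s * D) * exp (s * D) = 1"
      by (simp flip: exp_add)
    finally show ?thesis
      using arw_Z_pos[of G \<beta> n x i] arw_Z_pos[of G \<beta> n y i] by (simp add: field_simps)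
  qed
  have "1 - 2 * \<beta> * D / real n \<le> exp (- 2 * s * D)"
    using exp_ge_add_one_self[of "- 2 * s * D"] by (simp add: s_def)
  then have "(1 - 2 * \<beta> * D / real n) * pmf (arw_target G \<beta> n x i) j \<le>
      exp (- 2 * s * D) * pmf (arw_target G \<beta> n x i) j"
    by (rule mult_right_mono) simp
  also have "\<dots> \<le> pmf (arw_target G \<beta> n y i) j"
    using quot[OF xy[of i 1]] quot[OF xy[of j 0]] by (auto simp: pmf_arw_target s_def)
  finally show ?thesis .
qed

section \<open>Graph distance\<close>

text \<open>Here \<open>d\<close> is the graph distance and \<open>N\<close> the diameter; the first
  step of a shortest walk decreases the distance.\<close>

lemma ex_descending_distance:
  assumes "connected G"
  obtains d :: "'a \<Rightarrow> 'a \<Rightarrow> nat" and N where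
    "\<And>i j. d i j = 0 \<longleftrightarrow> i = j"
    "\<And>i j. i \<in> verts G \<Longrightarrow> j \<in> verts G \<Longrightarrow> i \<noteq> j \<Longrightarrow> \<exists>i'. i \<rightarrow> i' \<and> d i' j < d i j"
    "\<And>i j. i \<in> verts G \<Longrightarrow> j \<in> verts G \<Longrightarrow> d i j \<le> N"
proof -
  define R where "R = arcs_ends G"
  \<comment> \<open>Treating the diagonal separately and adding \<open>Suc\<close> makes
    \<open>d\<close> vanish exactly on the diagonal, even for unreachable pairs, where
    \<open>LEAST\<close> is unspecified.\<close>
  define d where "d = (\<lambda>i j. if i = j then 0 else Suc (LEAST m. (i, j) \<in> R ^^ Suc m))"
  have d0: "d i j = 0 \<longleftrightarrow> i = j" for i j
    by (simp add: d_def)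
  have step: "\<exists>i'. i \<rightarrow> i' \<and> d i' j < d i j" if ij: "i \<in> verts G" "j \<in> verts G" "i \<noteq> j" for i j
  proof -
    have "strongly_connected G"
      using assms sym_arcs by (rule symmetric_connected_imp_strongly_connected[rotated])
    then have "i \<rightarrow>\<^sup>* j"
      using ij by auto
    then have "(i, j) \<in> R\<^sup>+"
      using ij unfolding R_def by blast
    then have "\<exists>m. (i, j) \<in> R ^^ Suc m"
      by (metis trancl_power gr0_implies_Suc)
    then have "(i, j) \<in> R ^^ Suc (LEAST m. (i, j) \<in> R ^^ Suc m)" (is "_ \<in> R ^^ Suc ?m")
      by (rule LeastI_ex)
    then obtain i' where i': "(i, i') \<in> R" "(i', j) \<in> R ^^ ?m"
      by (meson relpow_Suc_D2)
    \<comment> \<open>Since \<open>d i j = Suc ?m\<close>, this is the strict decrease. If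
      \<open>i'\<close> is not yet \<open>j\<close>, then \<open>?m\<close> is positive and its
      predecessor is a candidate for the \<open>LEAST\<close> in \<open>d i' j\<close>.\<close>
    have "d i' j \<le> ?m"
    proof (cases "i' = j")
      case False
      then obtain m' where m': "?m = Suc m'"
        using i'(2) by (cases ?m) auto
      then have "(LEAST m. (i', j) \<in> R ^^ Suc m) \<le> m'"
        using i'(2) by (intro Least_le) simp
      then show ?thesis
        using False m' by (simp add: d_def)
    qed (simp add: d_def)
    then show ?thesis
      using i'(1) ij by (intro exI[of _ i']) (simp add: R_def d_def)
  qed
  have "d i j \<le> Max (case_prod d ` (verts G \<times> verts G))" if "i \<in> verts G" "j \<in> verts G" for i j
    using that by (intro Max_ge) auto
  with d0 step show ?thesis
    by (rule that)
qed

section \<open>Coupling the moves of two particles\<close>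

text \<open>The square bounds from below the probability that two independent particles both make
  prescribed moves.\<close>

lemma target_bound_sq:
  assumes "verts G \<noteq> {}"
  shows "(1 / (real (card (verts G)) * exp 1))\<^sup>2 > 0" "(1 / (real (card (verts G)) * exp 1))\<^sup>2 \<le> 1"
proof -
  have card: "real (card (verts G)) \<ge> 1"
    using assms by (simp add: Suc_le_eq card_gt_0_iff)
  then have "real (card (verts G)) * exp 1 \<ge> 1"
    using mult_mono[of 1 "real (card (verts G))" 1 "exp 1"] by simp
  then show "(1 / (real (card (verts G)) * exp 1))\<^sup>2 > 0"
      "(1 / (real (card (verts G)) * exp 1))\<^sup>2 \<le> 1"
    using card by (auto intro!: power_le_one)
qed

text \<open>
  The function \<open>h\<close> is so concave in the distance that the chance of at least \<open>p\<close> of a step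
  towards each other outweighs any increase: already \<open>h \<le> 2\<close> makes the drift negative.
\<close>

lemma ex_particle_coupling:
  fixes d :: "'a \<Rightarrow> 'a \<Rightarrow> nat" and N n :: nat and \<beta> :: real
  defines "p \<equiv> (1 / (real (card (verts G)) * exp 1))\<^sup>2"
  defines "h \<equiv> (\<lambda>a. 2 - 2 * (p / 2) ^ d (fst a) (snd a))"
  assumes d0: "\<And>i j. d i j = 0 \<longleftrightarrow> i = j"
    and step: "\<And>i j. i \<in> verts G \<Longrightarrow> j \<in> verts G \<Longrightarrow> i \<noteq> j \<Longrightarrow> \<exists>i'. i \<rightarrow> i' \<and> d i' j < d i j"
    and N: "\<And>i j. i \<in> verts G \<Longrightarrow> j \<in> verts G \<Longrightarrow> d i j \<le> N"
    and \<beta>: "0 \<le> \<beta>" "\<beta> \<le> 1 / 2"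
    and x: "x \<in> arw_states G n" "i \<in># x" and y: "y \<in> arw_states G n" "j \<in># y"
    and D: "\<And>l. \<bar>real (count x l) - real (count y l)\<bar> \<le> D" "D \<le> real n"
  shows "\<exists>c. map_pmf fst c = arw_target G \<beta> n x i \<and> map_pmf snd c = arw_target G \<beta> n y j \<and>
    measure_pmf.expectation c h \<le> h (i, j) - (if i = j then - (4 * \<beta> * D / real n) else p * (p / 2) ^ N)"
proof -
  have i: "i \<in> verts G" and j: "j \<in> verts G" and n: "n > 0"
    using x y by (auto simp: arw_states_def gr0_conv_Suc size_eq_Suc_imp_eq_union dest: multi_member_split)
  have p: "p > 0" "p \<le> 1"
    unfolding p_def using i target_bound_sq by blast+
  have \<theta>: "p / 2 > 0" "p / 2 \<le> 1"
    using p by auto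
  have D0: "D \<ge> 0"
    using D(1)[of i] by linarith
  have h2: "h a \<le> 2" for a
    using \<theta> by (simp add: h_def)
  have fin: "finite (set_pmf c)"
    if "map_pmf fst c = arw_target G \<beta> n x i" "map_pmf snd c = arw_target G \<beta> n y j" for c
    using that finite_set_arw_target by (intro finite_set_pmf_coupling) simp_all
  show ?thesis
  proof (cases "i = j")
    case True
    \<comment> \<open>The ratio bound for target distributions supplies exactly this
      \<open>\<delta>\<close>; it is at most 1 because \<open>\<beta> \<le> 1 / 2\<close> and
      \<open>D \<le> n\<close>. As \<open>h \<le> 2\<close>, splitting costs at most
      \<open>2 * \<delta> = 4 * \<beta> * D / n\<close>.\<close>
    define \<delta> where "\<delta> = 2 * \<beta> * D / real n"
    have "2 * \<beta> * D \<le> 1 * real n"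
      using \<beta> D D0 by (intro mult_mono) auto
    then have \<delta>: "0 \<le> \<delta>" "\<delta> \<le> 1"
      using \<beta> D0 n by (auto simp: \<delta>_def)
    obtain c where c: "map_pmf fst c = arw_target G \<beta> n x i" "map_pmf snd c = arw_target G \<beta> n y i"
        "measure_pmf.prob c {a. fst a \<noteq> snd a} \<le> \<delta>"
      using minorized_coupling[OF \<delta>, of "arw_target G \<beta> n x i" "arw_target G \<beta> n y i"]
        pmf_arw_target_ratio[OF D(1) \<beta>(1), of n i] by (auto simp: \<delta>_def)
    have "h a \<le> 2 * indicator {a. fst a \<noteq> snd a} a" for a
      using d0[of "fst a" "snd a"] h2[of a] by (auto simp: h_def indicator_def)
    then have "measure_pmf.expectation c h \<le>
        measure_pmf.expectation c (\<lambda>a. 2 * indicator {a. fst a \<noteq> snd a} a)"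
      using c True fin by (intro integral_mono integrable_measure_pmf_finite) auto
    also have "\<dots> \<le> 2 * \<delta>"
      using c(3) by simp
    also have "\<dots> = h (i, j) + 4 * \<beta> * D / real n"
      using True d0[of i i] by (simp add: h_def \<delta>_def)
    finally show ?thesis
      using c True by auto
  next
    case False
    obtain i' where i': "i \<rightarrow> i'" "d i' j < d i j"
      using step i j False by blast
    let ?m = "d i' j"
    have m: "?m \<le> N"
      using i' j by (intro N) (auto dest: adj_in_verts)
    define c where "c = pair_pmf (arw_target G \<beta> n x i) (arw_target G \<beta> n y j)"
    have c: "map_pmf fst c = arw_target G \<beta> n x i" "map_pmf snd c = arw_target G \<beta> n y j"
      by (simp_all add: c_def map_fst_pair_pmf map_snd_pair_pmf)
    \<comment> \<open>The favourable outcome: the first particle steps closer while the second one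
      stays.\<close>
    have "p \<le> pmf c (i', j)"
      using pmf_arw_target_ge[OF x \<beta>(1), of i'] pmf_arw_target_ge[OF y \<beta>(1), of j] i' \<beta>
      unfolding c_def pmf_pair p_def power2_eq_square by (intro mult_mono) auto
    then have pc: "p \<le> measure_pmf.prob c {(i', j)}"
      by (simp add: measure_pmf_single)
    have "h a \<le> 2 - 2 * (p / 2) ^ ?m * indicator {(i', j)} a" for a
      using h2[of a] by (auto simp: h_def indicator_def)
    then have "measure_pmf.expectation c h \<le>
        measure_pmf.expectation c (\<lambda>a. 2 - 2 * (p / 2) ^ ?m * indicator {(i', j)} a)"
      using c fin by (intro integral_mono integrable_measure_pmf_finite) auto
    also have "\<dots> = 2 - 2 * (p / 2) ^ ?m * measure_pmf.prob c {(i', j)}"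
      using c fin by (subst Bochner_Integration.integral_diff)
        (auto intro: integrable_measure_pmf_finite)
    also have "\<dots> \<le> 2 - 2 * (p / 2) ^ ?m * p"
      using pc \<theta> by simp
    also have "\<dots> \<le> h (i, j) - p * (p / 2) ^ N"
    proof -
      \<comment> \<open>With ratio \<open>p / 2\<close>, the term \<open>2 * (p / 2) ^ d i j\<close>
        is at most \<open>p * (p / 2) ^ ?m\<close>, half of the gain
        \<open>2 * p * (p / 2) ^ ?m\<close>. The other half remains as drift.\<close>
      have "(p / 2) ^ d i j \<le> (p / 2) ^ Suc ?m"
        using i'(2) \<theta> by (intro power_decreasing) auto
      moreover have "p * (p / 2) ^ N \<le> p * (p / 2) ^ ?m"
        using m \<theta> p by (intro mult_left_mono power_decreasing) auto
      ultimately show ?thesis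
        by (simp add: h_def algebra_simps)
    qed
    finally show ?thesis
      using c False by auto
  qed
qed

section \<open>Contraction of the coupled chain\<close>

text \<open>The constant is the drift \<open>\<gamma>\<close> of a split pair, which depends on the
  graph alone and so is fixed before \<open>\<beta>\<close> and \<open>n\<close>. The factor
  \<open>2 * n\<close> bounds the initial potential of \<open>n\<close> pairs.\<close>

lemma arw_contraction:
  assumes "connected G"
  obtains c where "0 < c" "c \<le> 1"
    "\<And>\<beta> n x y t. 0 \<le> \<beta> \<Longrightarrow> \<beta> \<le> c / 8 \<Longrightarrow> n > 0 \<Longrightarrow> x \<in> arw_states G n \<Longrightarrow> y \<in> arw_states G n \<Longrightarrow>
      tv_dist (kernel_power (arw_kernel G \<beta> n) t x) (kernel_power (arw_kernel G \<beta> n) t y)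
        \<le> (1 - c / (4 * real n)) ^ t * (2 * real n)"
proof -
  obtain d :: "'a \<Rightarrow> 'a \<Rightarrow> nat" and N where
    d0: "\<And>i j. d i j = 0 \<longleftrightarrow> i = j" and
    step: "\<And>i j. i \<in> verts G \<Longrightarrow> j \<in> verts G \<Longrightarrow> i \<noteq> j \<Longrightarrow> \<exists>i'. i \<rightarrow> i' \<and> d i' j < d i j" and
    N: "\<And>i j. i \<in> verts G \<Longrightarrow> j \<in> verts G \<Longrightarrow> d i j \<le> N"
    using ex_descending_distance[OF assms] by blast
  define p where "p = (1 / (real (card (verts G)) * exp 1))\<^sup>2"
  define h where "h = (\<lambda>a. 2 - 2 * (p / 2) ^ d (fst a) (snd a))"
  define \<gamma> where "\<gamma> = p * (p / 2) ^ N"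
  have "verts G \<noteq> {}"
    using assms by (auto simp: connected_conv)
  then have p: "p > 0" "p \<le> 1"
    unfolding p_def by (rule target_bound_sq)+
  have \<gamma>: "\<gamma> > 0" "\<gamma> \<le> 1"
    using p by (auto simp: \<gamma>_def intro!: mult_le_one power_le_one)
  have h: "h a \<ge> 0" "h a \<le> 2" "fst a \<noteq> snd a \<Longrightarrow> h a \<ge> 1" "fst a = snd a \<Longrightarrow> h a = 0" for a
  proof -
    show "h a \<ge> 0" "h a \<le> 2"
      using p by (auto simp: h_def intro!: power_le_one)
    show "h a = 0" if "fst a = snd a"
      using d0[of "fst a" "snd a"] that by (simp add: h_def)
    show "h a \<ge> 1" if "fst a \<noteq> snd a"
    proof -
      \<comment> \<open>A split pair has distance at least 1, and
        \<open>p / 2 \<le> 1 / 2\<close>.\<close>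
      have "(p / 2) ^ d (fst a) (snd a) \<le> (p / 2) ^ 1"
        using d0[of "fst a" "snd a"] that p by (intro power_decreasing) auto
      then show ?thesis
        using p by (simp add: h_def)
    qed
  qed
  show ?thesis
  proof (rule that[OF \<gamma>])
    fix \<beta> :: real and n :: nat and x y :: "'a multiset" and t :: nat
    assume \<beta>: "0 \<le> \<beta>" "\<beta> \<le> \<gamma> / 8" and n: "n > 0"
      and xy: "x \<in> arw_states G n" "y \<in> arw_states G n"
    define D where "D = (\<lambda>z :: ('a \<times> 'a) multiset. real (size {#a \<in># z. fst a \<noteq> snd a#}))"
    define \<Phi> where "\<Phi> = (\<lambda>z. \<Sum>a\<in>#z. h a)"
    \<comment> \<open>The invariant set of the coupled chain: multisets of \<open>n\<close> pairs of
      vertices.\<close>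
    define Z where "Z = {z. image_mset fst z \<in> arw_states G n \<and> image_mset snd z \<in> arw_states G n}"
    define drift where "drift = (\<lambda>z (a :: 'a \<times> 'a). if fst a = snd a then - (4 * \<beta> * D z / real n) else \<gamma>)"
    define good where "good = (\<lambda>z a c.
      map_pmf fst c = arw_target G \<beta> n (image_mset fst z) (fst a) \<and>
      map_pmf snd c = arw_target G \<beta> n (image_mset snd z) (snd a) \<and>
      measure_pmf.expectation c h \<le> h a - drift z a)"
    \<comment> \<open>A coupling is chosen for each pair, depending on the whole of \<open>z\<close>
      because the target distributions do.\<close>
    define C where "C = (\<lambda>z a. SOME c. good z a c)"
    have size: "size z = n" if "z \<in> Z" for z
      using that by (auto simp: Z_def arw_states_def)
    have C: "good z a (C z a)" if z: "z \<in> Z" "a \<in># z" for z a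
      unfolding C_def
    proof (rule someI_ex)
      have "D z \<le> real n"
        using size_filter_mset_lesseq[of _ z] size[OF z(1)] unfolding D_def by simp
      then show "\<exists>c. good z a c"
        using ex_particle_coupling[of d N \<beta> "image_mset fst z" n "fst a" "image_mset snd z" "snd a" "D z"]
          d0 step N \<beta> \<gamma> z abs_count_image_mset_diff_le[of z]
        unfolding good_def drift_def h_def \<gamma>_def p_def Z_def D_def by auto
    qed
    have ne: "z \<noteq> {#}" if "z \<in> Z" for z
      using size[OF that] n by auto
    let ?W = "replacement_kernel C"
    \<comment> \<open>A split pair weighs between 1 and 2 and a joined pair nothing. The lower bound
      detects disagreement, the upper one converts drift in \<open>D\<close> into drift in
      \<open>\<Phi>\<close>.\<close>
    have \<Phi>_bounds: "0 \<le> \<Phi> z" "\<Phi> z \<le> 2 * D z" "D z \<le> \<Phi> z" for z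
    proof -
      show "0 \<le> \<Phi> z"
        unfolding \<Phi>_def using h(1) by (induction z) auto
      show "\<Phi> z \<le> 2 * D z"
        unfolding \<Phi>_def D_def using h(2,4) by (induction z) (auto simp: add_mono algebra_simps)
      show "D z \<le> \<Phi> z"
        unfolding \<Phi>_def D_def using h(3,4) by (induction z) (auto simp: add_mono)
    qed
    have contr: "(\<integral>\<^sup>+z'. ennreal (\<Phi> z') \<partial>?W z) \<le> ennreal ((1 - \<gamma> / (4 * real n)) * \<Phi> z)"
      if z: "z \<in> Z" for z
    proof -
      have "finite (set_pmf (C z a))" if "a \<in># z" for a
        using C[OF z that] finite_set_arw_target unfolding good_def
        by (intro finite_set_pmf_coupling) (simp_all only: )
      then have "(\<integral>\<^sup>+z'. ennreal (\<Phi> z') \<partial>?W z) \<le>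
          ennreal (\<Phi> z - (\<Sum>a\<in>#z. drift z a) / real n)"
        unfolding \<Phi>_def using C[OF z] h(1) ne[OF z] nn_integral_replacement_kernel_le[of z h C "drift z"]
        by (simp add: size[OF z] good_def)
      also have "\<dots> \<le> ennreal ((1 - \<gamma> / (4 * real n)) * \<Phi> z)"
      proof (rule ennreal_leI)
        define s where "s = 4 * \<beta> * D z / real n"
        have s: "s \<ge> 0"
          using \<beta> by (simp add: s_def D_def)
        \<comment> \<open>Each split pair contributes \<open>\<gamma>\<close>, and each of the at
          most \<open>size z\<close> joined pairs costs \<open>s\<close>; in total the cost is at
          most \<open>4 * \<beta> * D z\<close>.\<close>
        have "\<gamma> * D z - s * real (size z) \<le> (\<Sum>a\<in>#z. if fst a = snd a then - s else \<gamma>)"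
          unfolding D_def using s by (induction z) (auto simp: algebra_simps)
        also have "\<dots> = (\<Sum>a\<in>#z. drift z a)"
          by (simp only: drift_def s_def)
        finally have "(\<gamma> - 4 * \<beta>) * D z \<le> (\<Sum>a\<in>#z. drift z a)"
          using n by (simp add: s_def size[OF z] algebra_simps)
        moreover have "\<gamma> / 4 * \<Phi> z \<le> \<gamma> / 4 * (2 * D z)"
          using \<gamma> \<Phi>_bounds(2) by (intro mult_left_mono) auto
        \<comment> \<open>As \<open>\<beta> \<le> \<gamma> / 8\<close>, joined pairs consume at most
          half of the drift.\<close>
        moreover have "(\<gamma> / 2) * D z \<le> (\<gamma> - 4 * \<beta>) * D z"
          using \<beta> by (intro mult_right_mono) (auto simp: D_def)
        ultimately have "\<gamma> / 4 * \<Phi> z \<le> (\<Sum>a\<in>#z. drift z a)"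
          by simp
        then have "\<gamma> / 4 * \<Phi> z / real n \<le> (\<Sum>a\<in>#z. drift z a) / real n"
          by (rule divide_right_mono) simp
        then show "\<Phi> z - (\<Sum>a\<in>#z. drift z a) / real n \<le> (1 - \<gamma> / (4 * real n)) * \<Phi> z"
          by (simp add: algebra_simps)
      qed
      finally show ?thesis .
    qed
    obtain z where z: "image_mset fst z = x" "image_mset snd z = y"
      using ex_pairing[of x y] xy by (auto simp: arw_states_def)
    then have zZ: "z \<in> Z"
      using xy by (simp add: Z_def)
    have closed: "set_pmf (?W z) \<subseteq> Z" if z: "z \<in> Z" for z
    proof
      fix z' assume "z' \<in> set_pmf (?W z)"
      then obtain a b where ab: "a \<in># z" "b \<in> set_pmf (C z a)" "z' = z - {#a#} + {#b#}"
        using set_replacement_kernel ne[OF z] by metis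
      have "fst b \<in> set_pmf (map_pmf fst (C z a))" "snd b \<in> set_pmf (map_pmf snd (C z a))"
        unfolding set_map_pmf using ab(2) by blast+
      moreover have "fst a \<in> verts G" "snd a \<in> verts G"
        using z ab(1) by (auto simp: Z_def arw_states_def)
      ultimately have "fst b \<in> verts G" "snd b \<in> verts G"
        using C[OF z ab(1)] unfolding good_def by (metis set_arw_target subsetD)+
      moreover have "size z' = n"
        using ab size[OF z] n by (simp add: size_Diff_singleton)
      ultimately show "z' \<in> Z"
        using z ab by (auto simp: Z_def arw_states_def dest!: in_diffD)
    qed
    have "tv_dist (kernel_power (arw_kernel G \<beta> n) t (image_mset fst z))
        (kernel_power (arw_kernel G \<beta> n) t (image_mset snd z)) \<le> (1 - \<gamma> / (4 * real n)) ^ t * \<Phi> z"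
    proof (rule tv_dist_kernel_power_coupling[where Z = Z and W = ?W])
      show "map_pmf (image_mset fst) (?W z) = arw_kernel G \<beta> n (image_mset fst z)" if "z \<in> Z" for z
        unfolding arw_kernel_eq_replacement_kernel using C[OF that] ne[OF that]
        by (intro map_replacement_kernel) (auto simp: good_def)
      show "map_pmf (image_mset snd) (?W z) = arw_kernel G \<beta> n (image_mset snd z)" if "z \<in> Z" for z
        unfolding arw_kernel_eq_replacement_kernel using C[OF that] ne[OF that]
        by (intro map_replacement_kernel) (auto simp: good_def)
      show "\<Phi> z \<ge> 1" if neq: "image_mset fst z \<noteq> image_mset snd z" for z
      proof -
        obtain a where "a \<in># z" "fst a \<noteq> snd a"
          using neq by (meson image_mset_cong)
        then have "a \<in># {#a \<in># z. fst a \<noteq> snd a#}"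
          by simp
        then have "{#a \<in># z. fst a \<noteq> snd a#} \<noteq> {#}"
          by force
        then have "D z \<ge> 1"
          by (simp add: D_def Suc_le_eq flip: nonempty_has_size)
        then show ?thesis
          using \<Phi>_bounds(3)[of z] by simp
      qed
      have "\<gamma> \<le> 4 * real n"
        using \<gamma> n by linarith
      then show "1 - \<gamma> / (4 * real n) \<ge> 0"
        using n by simp
    qed (use closed zZ \<Phi>_bounds contr in auto)
    also have "\<dots> \<le> (1 - \<gamma> / (4 * real n)) ^ t * (2 * real n)"
    proof (rule mult_left_mono)
      have "D z \<le> real n"
        using size_filter_mset_lesseq[of _ z] size[OF zZ] unfolding D_def by simp
      then show "\<Phi> z \<le> 2 * real n"
        using \<Phi>_bounds(2)[of z] by simp
      have "\<gamma> \<le> 4 * real n"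
        using \<gamma> n by linarith
      then show "(1 - \<gamma> / (4 * real n)) ^ t \<ge> 0"
        using n by simp
    qed
    finally show "tv_dist (kernel_power (arw_kernel G \<beta> n) t x) (kernel_power (arw_kernel G \<beta> n) t y)
        \<le> (1 - \<gamma> / (4 * real n)) ^ t * (2 * real n)"
      by (simp add: z)
  qed
qed

section \<open>From contraction to the mixing time\<close>

lemma finite_arw_states: "finite (arw_states G n)"
proof (rule finite_subset)
  show "arw_states G n \<subseteq> mset ` {xs. set xs \<subseteq> verts G \<and> length xs = n}"
  proof
    fix x assume x: "x \<in> arw_states G n"
    obtain xs where "x = mset xs"
      using ex_mset by metis
    with x show "x \<in> mset ` {xs. set xs \<subseteq> verts G \<and> length xs = n}"
      by (auto simp: arw_states_def)
  qed
qed (simp add: finite_lists_length_eq)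

lemma set_arw_kernel:
  assumes "x \<in> arw_states G n" "n > 0"
  shows "set_pmf (arw_kernel G \<beta> n x) \<subseteq> arw_states G n"
proof
  fix x' assume x': "x' \<in> set_pmf (arw_kernel G \<beta> n x)"
  have "x \<noteq> {#}"
    using assms by (auto simp: arw_states_def)
  then obtain i j where "i \<in># x" "j \<in> set_pmf (arw_target G \<beta> n x i)" "x' = x - {#i#} + {#j#}"
    using x' set_replacement_kernel unfolding arw_kernel_eq_replacement_kernel by metis
  then show "x' \<in> arw_states G n"
    using assms set_arw_target[of i]
    by (auto simp: arw_states_def size_Diff_singleton dest!: in_diffD)
qed

end

theorem theorem2:
  fixes G :: "('v, 'e) pre_digraph"
  assumes "graph G" and "Digraph_Component.connected G"
  shows "\<exists>\<beta>_minus::real. \<beta>_minus > 0 \<and>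
    (\<forall>\<beta>::real. 0 \<le> \<beta> \<and> \<beta> < \<beta>_minus \<longrightarrow>
      (\<exists>C::real. C > 0 \<and> (\<exists>n0::nat. \<forall>n\<ge>n0.
        ereal_of_enat (arw_mixing_time G \<beta> n) \<le> ereal (C * real n * ln (real n)))))"
proof -
  interpret graph G by fact
  obtain c where c: "0 < c" "c \<le> 1" and tv:
    "\<And>\<beta> n x y t. 0 \<le> \<beta> \<Longrightarrow> \<beta> \<le> c / 8 \<Longrightarrow> n > 0 \<Longrightarrow> x \<in> arw_states G n \<Longrightarrow> y \<in> arw_states G n \<Longrightarrow>
      tv_dist (kernel_power (arw_kernel G \<beta> n) t x) (kernel_power (arw_kernel G \<beta> n) t y)
        \<le> (1 - c / (4 * real n)) ^ t * (2 * real n)"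
    using arw_contraction[OF assms(2)] by blast
  obtain v where v: "v \<in> verts G"
    using assms(2) by (auto simp: connected_conv)
  \<comment> \<open>For \<open>n \<ge> 8\<close>, \<open>ln (8 * n) \<le> 2 * ln n\<close> doubles
    \<open>4 / c\<close> to \<open>8 / c\<close>; the extra 1 absorbs the rounding up of
    \<open>t\<close>.\<close>
  have bound: "ereal_of_enat (arw_mixing_time G \<beta> n) \<le> ereal ((8 / c + 1) * real n * ln (real n))"
    if \<beta>: "0 \<le> \<beta>" "\<beta> < c / 8" and n8: "n \<ge> 8" for \<beta> n
  proof -
    define e where "e = (\<lambda>t. (1 - c / (4 * real n)) ^ t * (2 * real n))"
    have n: "n > 0"
      using n8 by simp
    have "0 < c / (4 * real n)" "c / (4 * real n) \<le> 1"
      using c n by (auto simp: field_simps)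
    then have "e \<longlonglongrightarrow> 0 * (2 * real n)"
      unfolding e_def by (intro tendsto_mult LIMSEQ_realpow_zero) auto
    \<comment> \<open>The state space is nonempty: all particles may sit at
      \<open>v\<close>.\<close>
    moreover have "replicate_mset n v \<in> arw_states G n"
      using v by (auto simp: arw_states_def in_replicate_mset)
    ultimately have dist: "mixing_dist (arw_states G n) (arw_kernel G \<beta> n) t \<le> e t" for t
      using tv[of \<beta> n] \<beta> n finite_arw_states set_arw_kernel[of _ n \<beta>]
      by (intro mixing_dist_le) (auto simp: e_def)
    \<comment> \<open>At this time \<open>exp (- c * t / (4 * n))\<close> is at most
      \<open>1 / (8 * n)\<close>, which brings the prefactor \<open>2 * n\<close> down to
      1/4.\<close>
    define t where "t = nat \<lceil>4 * real n / c * ln (8 * real n)\<rceil>"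
    have ln8: "ln (8 * real n) \<ge> 0"
      using n8 by simp
    then have t_ge: "real t \<ge> 4 * real n / c * ln (8 * real n)"
      and t_le: "real t \<le> 4 * real n / c * ln (8 * real n) + 1"
      using c unfolding t_def by simp_all
    have "e t \<le> exp (- c / (4 * real n)) ^ t * (2 * real n)"
      unfolding e_def using exp_ge_add_one_self[of "- c / (4 * real n)"] \<open>c / (4 * real n) \<le> 1\<close>
      by (intro mult_right_mono power_mono) auto
    also have "exp (- c / (4 * real n)) ^ t = exp (- (c / (4 * real n) * real t))"
      by (simp flip: exp_of_nat_mult)
    also have "\<dots> * (2 * real n) \<le> exp (- ln (8 * real n)) * (2 * real n)"
    proof -
      have "c / (4 * real n) * (4 * real n / c * ln (8 * real n)) \<le> c / (4 * real n) * real t"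
        using t_ge c by (intro mult_left_mono) auto
      then show ?thesis
        using c n by (intro mult_right_mono) auto
    qed
    also have "\<dots> = 1 / 4"
      using n by (simp add: exp_minus field_simps)
    finally have "mixing_dist (arw_states G n) (arw_kernel G \<beta> n) t \<le> 1 / 4"
      using dist[of t] by simp
    then have "arw_mixing_time G \<beta> n \<le> enat t"
      unfolding arw_mixing_time_def mixing_time_def by (intro INF_lower) simp
    then have "ereal_of_enat (arw_mixing_time G \<beta> n) \<le> ereal (real t)"
      by (metis ereal_of_enat_le_iff ereal_of_enat_simps(1))
    also have "real t \<le> (8 / c + 1) * real n * ln (real n)"
    proof -
      have "ln (real n) \<ge> ln 8"
        using n8 by simp
      moreover have "ln (8 :: real) \<ge> 1"
        using exp_le by (subst ln_ge_iff) auto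
      moreover have "ln (8 * real n) = ln 8 + ln (real n)"
        using n by (simp add: ln_mult)
      ultimately have l: "ln (8 * real n) \<le> 2 * ln (real n)" "ln (real n) \<ge> 1"
        by auto
      have "4 * real n / c * ln (8 * real n) \<le> 4 * real n / c * (2 * ln (real n))"
        using l c by (intro mult_left_mono) auto
      moreover have "1 * 1 \<le> real n * ln (real n)"
        using l n8 by (intro mult_mono) auto
      ultimately show ?thesis
        using t_le by (simp add: algebra_simps)
    qed
    finally show ?thesis
      by simp
  qed
  show ?thesis
  proof (rule exI[of _ "c / 8"], intro conjI allI impI)
    fix \<beta> assume "0 \<le> \<beta> \<and> \<beta> < c / 8"
    moreover have "8 / c + 1 > 0"
      using c by (simp add: add_pos_pos)
    ultimately show "\<exists>C::real. C > 0 \<and> (\<exists>n0::nat. \<forall>n\<ge>n0.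
        ereal_of_enat (arw_mixing_time G \<beta> n) \<le> ereal (C * real n * ln (real n)))"
      using bound by blast
  qed (use c in simp)
qed

end
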